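(* Consider the problem of minimizing $f(x)=\frac1n\sum_{i=1}^n g_i(x)+h(x)$ over $x\in\mathbb{R}^p$, under the standing assumptions in the context, and let $x^*$ be an optimal solution. Suppose that for each $i=1,\dots,n$ the gradient $\nabla g_i$ and the Hessian $\nabla^2 g_i$ are Lipschitz continuous with constants $L_i>0$ and $K_i>0$ respectively, and that $h$ is strongly convex with parameter $\mu_h\ge0$. Run PROXTONE (defined in the context) from $x^0\in\operatorname{dom} f$ with exact Hessians, i.e. $H_0^i=\nabla^2 g_i(x^0)$ for all $i$ and $H_{k+1}^{j}=\nabla^2 g_{j}(x^{k+1})$ for the index $j=j_{k+1}$ sampled at iteration $k$, and suppose there are constants $0<m\le M$ such that $L_iI\preceq mI\preceq H_k^i\preceq MI$ for all $i=1,\dots,n$ and all $k\ge0$. Let $L_{\max}=\max_i L_i$ and $K_{avg}=\frac1n\sum_{i=1}^nK_i$. Then PROXTONE converges to $x^*$ in expectation at an exponential rate, in the sense that for all $k\ge1$ $$\mathbb{E}\bigl[\|x^{k+1}-x^*\|\bigr]\le\left(\frac{K_{avg}+2L_{\max}}{m}\,\frac{M+L_{\max}}{2\mu_h+m}+\frac{2L_{\max}}{m}\right)\left[\frac1n\,\frac{M+L_{\max}}{2\mu_h+m}+\Bigl(1-\frac1n\Bigr)\right]^{k-1}\|x^*-x^0\|^2 .$$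
   Context: Standing assumptions: $h:\mathbb{R}^p\to\mathbb{R}\cup\{+\infty\}$ is proper, convex and lower semicontinuous, with closed effective domain $\operatorname{dom}(h)=\{x: h(x)<+\infty\}$. Each $g_i$ is convex and (here, twice) differentiable on an open set containing $\operatorname{dom}(h)$; Lipschitz continuity means $\|\nabla g_i(x)-\nabla g_i(y)\|\le L_i\|x-y\|$ and $\|\nabla^2 g_i(x)-\nabla^2 g_i(y)\|\le K_i\|x-y\|$ for all $x,y\in\operatorname{dom}(h)$ (Euclidean and spectral norms). Thus $\operatorname{dom} f=\operatorname{dom} h$. The minimum of $f$ is attained at some (not necessarily unique) $x^*$. Strong convexity: a convex function $\varphi$ is strongly convex with parameter $\mu\ge0$ if $\varphi(y)\ge \varphi(x)+\xi^T(y-x)+\frac{\mu}{2}\|y-x\|^2$ for all $x\in\operatorname{dom}\varphi$, $y\in\mathbb{R}^p$, $\xi\in\partial \varphi(x)$; $\mu=0$ is ordinary convexity. For symmetric matrices, $A\preceq B$ means $B-A$ is positive semidefinite. PROXTONE method. Start from $x^0\in\operatorname{dom} f$ and symmetric positive definite matrices $H_0^i$ ($i=1,\dots,n$), and set $$g_i^0(x)=g_i(x^0)+(x-x^0)^T\nabla g_i(x^0)+\tfrac12(x-x^0)^TH_0^i(x-x^0),\qquad G^0=\frac1n\sum_{i=1}^n g_i^0 .$$ For $k=0,1,2,\dots$: (1) $x^{k+1}=\arg\min_x\,[G^k(x)+h(x)]$; (2) sample an index $j=j_{k+1}$ uniformly from $\{1,\dots,n\}$, independently of the past; (3) with a symmetric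 positive definite matrix $H_{k+1}^j$, set $$g_j^{k+1}(x)=g_j(x^{k+1})+(x-x^{k+1})^T\nabla g_j(x^{k+1})+\tfrac12(x-x^{k+1})^TH_{k+1}^j(x-x^{k+1});$$ for $i\ne j$ keep $g_i^{k+1}=g_i^k$ and $H_{k+1}^i=H_k^i$; set $G^{k+1}=\frac1n\sum_{i=1}^n g_i^{k+1}$. Hence $H_k^i$ is the Hessian of the quadratic $g_i^k$. Expectations are with respect to the sampled indices. *)

theory Defs
  imports "HOL-Probability.Probability"
begin

definition edom :: "('a \<Rightarrow> ereal) \<Rightarrow> 'a set" where
  "edom \<phi> = {x. \<phi> x < \<infinity>}"

definition proper_fun :: "('a \<Rightarrow> ereal) \<Rightarrow> bool" where
  "proper_fun \<phi> \<longleftrightarrow> (\<forall>x. \<phi> x \<noteq> -\<infinity>) \<and> edom \<phi> \<noteq> {}"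

(* Intended for functions that never take the value -\<infinity>; in ereal, 0 * \<infinity> = 0, so the
   cases u = 0 and v = 0 are harmless. *)
definition convex_efun :: "('a::real_vector \<Rightarrow> ereal) \<Rightarrow> bool" where
  "convex_efun \<phi> \<longleftrightarrow> (\<forall>x y. \<forall>u\<ge>0. \<forall>v\<ge>0. u + v = (1::real) \<longrightarrow>
     \<phi> (u *\<^sub>R x + v *\<^sub>R y) \<le> ereal u * \<phi> x + ereal v * \<phi> y)"

definition lsc_efun :: "('a::topological_space \<Rightarrow> ereal) \<Rightarrow> bool" where
  "lsc_efun \<phi> \<longleftrightarrow> (\<forall>x. \<phi> x \<le> Liminf (at x) \<phi>)"

definition subdifferential :: "('a::real_inner \<Rightarrow> ereal) \<Rightarrow> 'a \<Rightarrow> 'a set" where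
  "subdifferential \<phi> x = {\<xi>. \<forall>y. \<phi> x + ereal (\<xi> \<bullet> (y - x)) \<le> \<phi> y}"

definition strongly_convex_efun :: "('a::real_inner \<Rightarrow> ereal) \<Rightarrow> real \<Rightarrow> bool" where
  "strongly_convex_efun \<phi> \<mu> \<longleftrightarrow> 0 \<le> \<mu> \<and> convex_efun \<phi> \<and>
     (\<forall>x\<in>edom \<phi>. \<forall>y. \<forall>\<xi>\<in>subdifferential \<phi> x.
        \<phi> x + ereal (\<xi> \<bullet> (y - x) + \<mu> / 2 * (norm (y - x))\<^sup>2) \<le> \<phi> y)"

definition symmetric_mat :: "real^'p^'p \<Rightarrow> bool" where
  "symmetric_mat A \<longleftrightarrow> transpose A = A"

definition pos_def_mat :: "real^'p^'p \<Rightarrow> bool" where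
  "pos_def_mat A \<longleftrightarrow> symmetric_mat A \<and> (\<forall>v. v \<noteq> 0 \<longrightarrow> 0 < v \<bullet> (A *v v))"

definition loewner_le :: "real^'p^'p \<Rightarrow> real^'p^'p \<Rightarrow> bool" (infix "\<preceq>\<^sub>L" 50) where
  "A \<preceq>\<^sub>L B \<longleftrightarrow> symmetric_mat A \<and> symmetric_mat B \<and> (\<forall>v. 0 \<le> v \<bullet> ((B - A) *v v))"

definition composite :: "nat \<Rightarrow> (nat \<Rightarrow> 'a \<Rightarrow> real) \<Rightarrow> ('a \<Rightarrow> ereal) \<Rightarrow> 'a \<Rightarrow> ereal" where
  "composite n g h x = ereal ((\<Sum>i=1..n. g i x) / real n) + h x"

definition quad_model ::
    "(real^'p \<Rightarrow> real) \<Rightarrow> (real^'p \<Rightarrow> real^'p) \<Rightarrow> real^'p^'p \<Rightarrow> real^'p \<Rightarrow> real^'p \<Rightarrow> real" where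
  "quad_model \<gamma> D\<gamma> A z x = \<gamma> z + (x - z) \<bullet> D\<gamma> z + 1 / 2 * ((x - z) \<bullet> (A *v (x - z)))"

(* surrogate g Dg j H x k i is the quadratic g_i^k along a path with sampled indices
   j 1, j 2, ..., matrices H k i = H_k^i and iterates x 0, x 1, ...; Dg i is the gradient of g i. *)
primrec surrogate ::
    "(nat \<Rightarrow> real^'p \<Rightarrow> real) \<Rightarrow> (nat \<Rightarrow> real^'p \<Rightarrow> real^'p) \<Rightarrow> (nat \<Rightarrow> nat) \<Rightarrow>
     (nat \<Rightarrow> nat \<Rightarrow> real^'p^'p) \<Rightarrow> (nat \<Rightarrow> real^'p) \<Rightarrow> nat \<Rightarrow> nat \<Rightarrow> real^'p \<Rightarrow> real" where
  "surrogate g Dg j H x 0 i = quad_model (g i) (Dg i) (H 0 i) (x 0)"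
| "surrogate g Dg j H x (Suc k) i =
     (if i = j (Suc k) then quad_model (g i) (Dg i) (H (Suc k) i) (x (Suc k))
      else surrogate g Dg j H x k i)"

(* One sample path of PROXTONE. The minimizer in each step is unique because all H k i are
   positive definite, so is_arg_min determines x (Suc k). *)
definition proxtone_path ::
    "nat \<Rightarrow> (nat \<Rightarrow> real^'p \<Rightarrow> real) \<Rightarrow> (nat \<Rightarrow> real^'p \<Rightarrow> real^'p) \<Rightarrow> (real^'p \<Rightarrow> ereal) \<Rightarrow>
     real^'p \<Rightarrow> (nat \<Rightarrow> nat) \<Rightarrow> (nat \<Rightarrow> nat \<Rightarrow> real^'p^'p) \<Rightarrow> (nat \<Rightarrow> real^'p) \<Rightarrow> bool" where
  "proxtone_path n g Dg h x0 j H x \<longleftrightarrow>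
     x 0 = x0 \<and>
     (\<forall>k. \<forall>i\<in>{1..n}. pos_def_mat (H k i)) \<and>
     (\<forall>k. \<forall>i\<in>{1..n}. i \<noteq> j (Suc k) \<longrightarrow> H (Suc k) i = H k i) \<and>
     (\<forall>k. is_arg_min (composite n (surrogate g Dg j H x k) h) (\<lambda>_. True) (x (Suc k)))"

(* The Hessians used by the method are those of the functions g i at the points where the
   quadratics are formed; D2g i is the Hessian of g i. *)
definition exact_hessians ::
    "nat \<Rightarrow> (nat \<Rightarrow> real^'p \<Rightarrow> real^'p^'p) \<Rightarrow> (nat \<Rightarrow> nat) \<Rightarrow>
     (nat \<Rightarrow> nat \<Rightarrow> real^'p^'p) \<Rightarrow> (nat \<Rightarrow> real^'p) \<Rightarrow> bool" where
  "exact_hessians n D2g j H x \<longleftrightarrow>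
     (\<forall>i\<in>{1..n}. H 0 i = D2g i (x 0)) \<and>
     (\<forall>k. H (Suc k) (j (Suc k)) = D2g (j (Suc k)) (x (Suc k)))"

(* j 1, j 2, ... are mutually independent and uniform on {1..n}; the value j 0 is unused. *)
definition uniform_sampling :: "'w measure \<Rightarrow> nat \<Rightarrow> (nat \<Rightarrow> 'w \<Rightarrow> nat) \<Rightarrow> bool" where
  "uniform_sampling P n j \<longleftrightarrow> prob_space P \<and>
     prob_space.indep_vars P (\<lambda>_. count_space {1..n}) j {1..} \<and>
     (\<forall>k\<ge>1. distr P (count_space {1..n}) (j k) = uniform_count_measure {1..n})"

end

theory Submission
  imports Defs
begin

text \<open>
  Let \<open>z_i\<close> be the anchor of \<open>g_i^k\<close>, the point at which this quadratic was built, and write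
  \<open>\<rho> = (M + Lmax) / (2 \<mu>h + m)\<close>. A single minimization of the model satisfies two deterministic
  estimates, each comparing the new iterate \<open>y\<close> with the anchors:

  \<^item> \<open>(2 \<mu>h + m) |y - xstar|^2\<close> is at most \<open>M\<close> times the average of \<open>|z_i - xstar|^2\<close>
    (\<open>model_min_square_distance\<close>). The model majorizes the smooth part because \<open>L_i \<le> m\<close>, so the
    growth of the model at \<open>y\<close> plus the growth of the objective at \<open>xstar\<close> is bounded by the gap
    between model and objective at \<open>xstar\<close>.

  \<^item> \<open>2 (\<mu>h + m) |y - xstar|\<close> is at most the average of \<open>K_i |z_i - xstar|^2\<close>
    (\<open>model_min_distance\<close>). Here the optimality conditions at \<open>y\<close> and at \<open>xstar\<close> are subtracted; as
    the Hessians are exact, the model gradient at \<open>xstar\<close> is wrong only by a Taylor remainder of second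
    order.

  The first estimate yields a recursion for the mean square distance of the anchors. A model has only one
  minimizer (\<open>model_min_unique\<close>), so the anchors at time \<open>k\<close> and the iterate \<open>k + 1\<close> are functions of
  the first \<open>k\<close> samples and hence independent of the next one. The next sample replaces each
  anchor by the new iterate with probability \<open>1 / n\<close> (\<open>expectation_independent_choice\<close>). By induction
  the expectation of \<open>|z_i - xstar|^2\<close> at time \<open>k\<close> is, for every \<open>i\<close>, at most
  \<open>q^k |x0 - xstar|^2\<close> with \<open>q = \<rho> / n + (1 - 1 / n)\<close>.

  Taking expectations in the second estimate then bounds the mean distance of the iterate \<open>k + 1\<close> by
  \<open>Kavg / (2 (\<mu>h + m)) * q^k |x0 - xstar|^2\<close>, where the square on the right-hand side comes from the
  Taylor remainder. As \<open>q\<close> is at most the larger of \<open>1\<close> and \<open>\<rho>\<close>, one factor \<open>q\<close> can be absorbed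
  into the constant of the claim (\<open>rate_comparison\<close>).
\<close>

section \<open>Smooth functions along a segment\<close>

text \<open>
  Both the descent lemma and the Taylor estimate for the gradient reduce to this one-dimensional
  fact along a segment.
\<close>

lemma second_order_upper_bound:
  fixes \<phi> \<phi>' :: "real \<Rightarrow> real"
  assumes deriv: "\<And>t. 0 \<le> t \<Longrightarrow> t \<le> 1 \<Longrightarrow> DERIV \<phi> t :> \<phi>' t"
    and slope: "\<And>t. 0 \<le> t \<Longrightarrow> t \<le> 1 \<Longrightarrow> \<phi>' t \<le> \<phi>' 0 + C * t"
  shows "\<phi> 1 \<le> \<phi> 0 + \<phi>' 0 + C / 2"
proof -
  define \<psi> where "\<psi> t = \<phi> t - \<phi>' 0 * t - C / 2 * t\<^sup>2" for t
  have "\<psi> 0 \<ge> \<psi> 1"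
  proof (rule DERIV_nonpos_imp_nonincreasing[of 0 1 \<psi>])
    fix t :: real assume t: "0 \<le> t" "t \<le> 1"
    have "DERIV \<psi> t :> \<phi>' t - \<phi>' 0 - C * t"
      unfolding \<psi>_def using t by (auto intro!: derivative_eq_intros deriv)
    then show "\<exists>y. DERIV \<psi> t :> y \<and> y \<le> 0"
      using slope[OF t] by force
  qed simp
  then show ?thesis by (simp add: \<psi>_def)
qed

lemma GDERIV_along_line:
  fixes \<phi> :: "'a::real_inner \<Rightarrow> real"
  assumes "GDERIV \<phi> (a + t *\<^sub>R v) :> D"
  shows "DERIV (\<lambda>t. \<phi> (a + t *\<^sub>R v)) t :> D \<bullet> v"
proof -
  have "((\<lambda>t. a + t *\<^sub>R v) has_derivative (\<lambda>s. s *\<^sub>R v)) (at t)"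
    by (auto intro!: derivative_eq_intros)
  from has_derivative_compose[OF this, of \<phi> "\<lambda>h. h \<bullet> D"] assms
  show ?thesis
    by (simp add: gderiv_def has_field_derivative_def inner_commute mult_commute_abs)
qed

text \<open>
  The derivative is a limit of secant slopes; this turns convexity, which bounds the secant
  slopes, into first-order inequalities.
\<close>

lemma directional_derivative_le:
  fixes \<phi> :: "'a::real_inner \<Rightarrow> real"
  assumes "GDERIV \<phi> a :> D"
    and secant: "\<And>t. 0 < t \<Longrightarrow> t \<le> 1 \<Longrightarrow> \<phi> (a + t *\<^sub>R v) - \<phi> a \<le> t * c"
  shows "D \<bullet> v \<le> c"
proof -
  have "DERIV (\<lambda>t. \<phi> (a + t *\<^sub>R v)) 0 :> D \<bullet> v"
    using assms(1) by (intro GDERIV_along_line) simp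
  then have "((\<lambda>t. (\<phi> (a + t *\<^sub>R v) - \<phi> a) / t) \<longlongrightarrow> D \<bullet> v) (at_right 0)"
    by (auto simp: DERIV_def intro: filterlim_mono[OF _ order_refl at_le])
  moreover have "\<forall>\<^sub>F t in at_right 0. (\<phi> (a + t *\<^sub>R v) - \<phi> a) / t \<le> c"
    unfolding eventually_at_right_field
    by (rule exI[of _ 1]) (auto simp: divide_le_eq mult.commute intro!: secant)
  ultimately show ?thesis
    by (rule tendsto_upperbound) simp
qed

lemma convex_on_gradient_inequality:
  fixes \<phi> :: "'a::real_inner \<Rightarrow> real"
  assumes conv: "convex_on S \<phi>" and "a \<in> S" "y \<in> S" and grad: "GDERIV \<phi> a :> D"
  shows "\<phi> a + D \<bullet> (y - a) \<le> \<phi> y"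
proof -
  have "D \<bullet> (y - a) \<le> \<phi> y - \<phi> a"
    using grad
  proof (rule directional_derivative_le)
    fix t :: real assume "0 < t" "t \<le> 1"
    then have "\<phi> ((1 - t) *\<^sub>R a + t *\<^sub>R y) \<le> (1 - t) * \<phi> a + t * \<phi> y"
      using assms by (intro convex_onD[OF conv]) auto
    moreover have "(1 - t) *\<^sub>R a + t *\<^sub>R y = a + t *\<^sub>R (y - a)"
      by (simp add: algebra_simps)
    ultimately show "\<phi> (a + t *\<^sub>R (y - a)) - \<phi> a \<le> t * (\<phi> y - \<phi> a)"
      by (simp add: algebra_simps)
  qed
  then show ?thesis by simp
qed

lemma descent_lemma:
  fixes \<gamma> :: "'a::real_inner \<Rightarrow> real"
  assumes S: "convex S" "z \<in> S" "y \<in> S"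
    and grad: "\<And>w. w \<in> S \<Longrightarrow> GDERIV \<gamma> w :> D w"
    and lip: "L-lipschitz_on S D"
  shows "\<gamma> y \<le> \<gamma> z + D z \<bullet> (y - z) + L / 2 * (norm (y - z))\<^sup>2"
proof -
  have seg: "z + t *\<^sub>R (y - z) \<in> S" if "0 \<le> t" "t \<le> 1" for t
    using convexD_alt[OF S that] by (simp add: algebra_simps)
  have "\<gamma> (z + 1 *\<^sub>R (y - z)) \<le> \<gamma> (z + 0 *\<^sub>R (y - z)) + D (z + 0 *\<^sub>R (y - z)) \<bullet> (y - z)
      + L * (norm (y - z))\<^sup>2 / 2"
  proof (rule second_order_upper_bound)
    fix t :: real assume t: "0 \<le> t" "t \<le> 1"
    show "DERIV (\<lambda>t. \<gamma> (z + t *\<^sub>R (y - z))) t :> D (z + t *\<^sub>R (y - z)) \<bullet> (y - z)"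
      by (intro GDERIV_along_line grad seg t)
    have "(D (z + t *\<^sub>R (y - z)) - D z) \<bullet> (y - z) \<le> norm (D (z + t *\<^sub>R (y - z)) - D z) * norm (y - z)"
      by (rule norm_cauchy_schwarz)
    also have "\<dots> \<le> (L * (t * norm (y - z))) * norm (y - z)"
      using lipschitz_onD[OF lip seg[OF t] S(2)] t
      by (intro mult_right_mono) (auto simp: dist_norm)
    finally show "D (z + t *\<^sub>R (y - z)) \<bullet> (y - z)
        \<le> D (z + 0 *\<^sub>R (y - z)) \<bullet> (y - z) + L * (norm (y - z))\<^sup>2 * t"
      by (simp add: inner_diff_left power2_eq_square mult_ac)
  qed
  then show ?thesis by simp
qed

text \<open>
  Testing against a fixed vector \<open>u\<close> makes the vector-valued Taylor remainder scalar, and avoids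
  integrating the Hessian along the segment. The factor \<open>1 / 2\<close> matters in \<open>rate_comparison\<close>.
\<close>

lemma gradient_taylor_bound:
  fixes D :: "real^'p \<Rightarrow> real^'p"
  assumes S: "convex S" "z \<in> S" "y \<in> S"
    and deriv: "\<And>w. w \<in> S \<Longrightarrow> (D has_derivative (\<lambda>v. D2 w *v v)) (at w)"
    and lip: "\<And>w. w \<in> S \<Longrightarrow> onorm (\<lambda>v. (D2 w - D2 z) *v v) \<le> K * norm (w - z)"
  shows "(D y - D z - D2 z *v (y - z)) \<bullet> u \<le> K / 2 * (norm (y - z))\<^sup>2 * norm u"
proof -
  have seg: "z + t *\<^sub>R (y - z) \<in> S" if "0 \<le> t" "t \<le> 1" for t
    using convexD_alt[OF S that] by (simp add: algebra_simps)
  have "D (z + 1 *\<^sub>R (y - z)) \<bullet> u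
      \<le> D (z + 0 *\<^sub>R (y - z)) \<bullet> u + (D2 (z + 0 *\<^sub>R (y - z)) *v (y - z)) \<bullet> u
        + K * (norm (y - z))\<^sup>2 * norm u / 2"
  proof (rule second_order_upper_bound)
    fix t :: real assume t: "0 \<le> t" "t \<le> 1"
    let ?w = "z + t *\<^sub>R (y - z)"
    have "((\<lambda>t. z + t *\<^sub>R (y - z)) has_derivative (\<lambda>s. s *\<^sub>R (y - z))) (at t)"
      by (auto intro!: derivative_eq_intros)
    from has_derivative_compose[OF this deriv[OF seg[OF t]]]
    show "DERIV (\<lambda>t. D (z + t *\<^sub>R (y - z)) \<bullet> u) t :> (D2 ?w *v (y - z)) \<bullet> u"
      unfolding has_field_derivative_def
      by (rule has_derivative_eq_rhs[OF has_derivative_inner_left])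
        (auto simp: matrix_vector_mult_scaleR)
    have "((D2 ?w - D2 z) *v (y - z)) \<bullet> u \<le> norm ((D2 ?w - D2 z) *v (y - z)) * norm u"
      by (rule norm_cauchy_schwarz)
    also have "\<dots> \<le> (onorm (\<lambda>v. (D2 ?w - D2 z) *v v) * norm (y - z)) * norm u"
      by (intro mult_right_mono onorm matrix_vector_mul_bounded_linear) auto
    also have "\<dots> \<le> ((K * norm (?w - z)) * norm (y - z)) * norm u"
      by (intro mult_right_mono lip seg t) auto
    finally show "(D2 ?w *v (y - z)) \<bullet> u
        \<le> (D2 (z + 0 *\<^sub>R (y - z)) *v (y - z)) \<bullet> u + K * (norm (y - z))\<^sup>2 * norm u * t"
      using t by (simp add: matrix_vector_mult_diff_rdistrib inner_diff_left power2_eq_square mult_ac)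
  qed
  then show ?thesis by (simp add: inner_diff_left)
qed

section \<open>Minimizers of smooth plus convex functions\<close>

lemma edom_finite_value:
  assumes "proper_fun h" "a \<in> edom h"
  shows "h a = ereal (real_of_ereal (h a))"
  using assms by (cases "h a") (auto simp: proper_fun_def edom_def)

lemma convex_edom:
  assumes "proper_fun h" "convex_efun h"
  shows "convex (edom h)"
proof (rule convexI)
  fix a b :: 'a and u v :: real
  assume ab: "a \<in> edom h" "b \<in> edom h" and uv: "0 \<le> u" "0 \<le> v" "u + v = 1"
  have "h (u *\<^sub>R a + v *\<^sub>R b) \<le> ereal u * h a + ereal v * h b"
    using assms(2) uv unfolding convex_efun_def by blast
  also have "\<dots> < \<infinity>"
    by (subst (1 2) edom_finite_value[OF assms(1)]) (use ab in auto)
  finally show "u *\<^sub>R a + v *\<^sub>R b \<in> edom h" by (simp add: edom_def)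
qed

lemma minimizer_in_edom:
  assumes "proper_fun h" and "\<And>y. ereal (\<phi> a) + h a \<le> ereal (\<phi> y) + h y"
  shows "a \<in> edom h"
proof -
  obtain b where "b \<in> edom h" using assms(1) by (auto simp: proper_fun_def)
  with assms(2)[of b] show ?thesis
    by (cases "h a"; cases "h b") (auto simp: edom_def)
qed

text \<open>
  Fermat's rule: along the segment from the minimizer \<open>a\<close> to \<open>y\<close>, any decrease of \<open>\<phi>\<close> is at most
  the increase of \<open>h\<close>, which by convexity is at most linear in the step.
\<close>

lemma minimizer_neg_gradient_in_subdifferential:
  assumes proper: "proper_fun h" and conv: "convex_efun h"
    and min: "\<And>y. ereal (\<phi> a) + h a \<le> ereal (\<phi> y) + h y"
    and grad: "GDERIV \<phi> a :> D"
  shows "- D \<in> subdifferential h a"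
  unfolding subdifferential_def
proof (intro CollectI allI)
  fix y
  show "h a + ereal (- D \<bullet> (y - a)) \<le> h y"
  proof (cases "y \<in> edom h")
    case False
    then show ?thesis by (simp add: edom_def)
  next
    case True
    define ha hy where "ha = real_of_ereal (h a)" and "hy = real_of_ereal (h y)"
    have a: "a \<in> edom h" by (rule minimizer_in_edom[OF proper min])
    have ha: "h a = ereal ha" and hy: "h y = ereal hy"
      using edom_finite_value[OF proper] True a by (auto simp: ha_def hy_def)
    have "- D \<bullet> (y - a) \<le> hy - ha"
    proof (rule directional_derivative_le)
      show "GDERIV (\<lambda>w. - \<phi> w) a :> - D" using grad by (rule GDERIV_minus)
      fix t :: real assume t: "0 < t" "t \<le> 1"
      have eq: "(1 - t) *\<^sub>R a + t *\<^sub>R y = a + t *\<^sub>R (y - a)" by (simp add: algebra_simps)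
      have "ereal (\<phi> a) + h a \<le> ereal (\<phi> (a + t *\<^sub>R (y - a))) + h (a + t *\<^sub>R (y - a))"
        by (rule min)
      also have "h (a + t *\<^sub>R (y - a)) \<le> ereal (1 - t) * h a + ereal t * h y"
        using conv t unfolding convex_efun_def eq[symmetric] by (metis add.commute diff_add_cancel diff_ge_0_iff_ge less_imp_le)
      finally have "\<phi> a + ha \<le> \<phi> (a + t *\<^sub>R (y - a)) + ((1 - t) * ha + t * hy)"
        by (simp add: ha hy add_left_mono)
      then show "- \<phi> (a + t *\<^sub>R (y - a)) - - \<phi> a \<le> t * (hy - ha)"
        by (simp add: algebra_simps)
    qed
    then show ?thesis by (simp add: ha hy)
  qed
qed

text \<open>
  Real values in place of extended ones make linear arithmetic applicable below.
\<close>

lemma strongly_convex_growth: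
  assumes proper: "proper_fun h" and "strongly_convex_efun h \<mu>"
    and "a \<in> edom h" "y \<in> edom h" "\<xi> \<in> subdifferential h a"
  shows "real_of_ereal (h a) + \<xi> \<bullet> (y - a) + \<mu> / 2 * (norm (y - a))\<^sup>2 \<le> real_of_ereal (h y)"
proof -
  have "h a + ereal (\<xi> \<bullet> (y - a) + \<mu> / 2 * (norm (y - a))\<^sup>2) \<le> h y"
    using assms unfolding strongly_convex_efun_def by blast
  then show ?thesis
    by (subst (asm) (1 2) edom_finite_value[OF proper]) (use assms in auto)
qed

section \<open>Quadratic models\<close>

lemma symmetric_mat_inner_commute:
  "symmetric_mat A \<Longrightarrow> u \<bullet> (A *v v) = v \<bullet> (A *v u)"
  by (metis dot_lmul_matrix inner_commute symmetric_mat_def vector_transpose_matrix)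

text \<open>
  The Taylor expansion of the quadratic about an arbitrary point \<open>a\<close> rather than about its
  anchor \<open>z\<close>; it exhibits the gradient at \<open>a\<close> and the constant Hessian.
\<close>

lemma quad_model_expansion:
  assumes "symmetric_mat A"
  shows "quad_model \<gamma> D A z y = quad_model \<gamma> D A z a + (D z + A *v (a - z)) \<bullet> (y - a)
           + 1 / 2 * ((y - a) \<bullet> (A *v (y - a)))"
proof -
  define p q where "p = y - a" and "q = a - z"
  have "y = a + p" "a = z + q" by (auto simp: p_def q_def)
  then show ?thesis
    using symmetric_mat_inner_commute[OF assms, of p q]
    by (simp add: quad_model_def matrix_vector_right_distrib inner_add_left inner_add_right
        inner_commute algebra_simps)
qed

lemma quad_model_GDERIV:
  assumes "symmetric_mat A"
  shows "GDERIV (quad_model \<gamma> D A z) a :> D z + A *v (a - z)"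
proof -
  have eq: "quad_model \<gamma> D A z = (\<lambda>y. quad_model \<gamma> D A z a + (D z + A *v (a - z)) \<bullet> (y - a)
           + 1 / 2 * ((y - a) \<bullet> (A *v (y - a))))"
    by (rule ext) (rule quad_model_expansion[OF assms])
  show ?thesis
    unfolding gderiv_def
    by (subst eq) (auto intro!: derivative_eq_intros has_derivative_inner bounded_linear.has_derivative[OF matrix_vector_mul_bounded_linear] simp: inner_commute)
qed

lemma GDERIV_average:
  assumes "\<And>i. i \<in> I \<Longrightarrow> GDERIV (q i) a :> G i"
  shows "GDERIV (\<lambda>y. (\<Sum>i\<in>I. q i y) / c) a :> (\<Sum>i\<in>I. G i) /\<^sub>R c"
  using assms unfolding gderiv_def
  by (auto intro!: derivative_eq_intros simp: inner_sum_right divide_inverse mult.commute)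

section \<open>One model minimization\<close>

text \<open>
  The smoothness hypotheses concern only \<open>edom h\<close>: this convex set contains every minimizer and every
  iterate, hence also all segments between them.
\<close>

locale composite_problem =
  fixes n :: nat
    and g :: "nat \<Rightarrow> real^'p \<Rightarrow> real"
    and Dg :: "nat \<Rightarrow> real^'p \<Rightarrow> real^'p"
    and D2g :: "nat \<Rightarrow> real^'p \<Rightarrow> real^'p^'p"
    and h :: "real^'p \<Rightarrow> ereal"
    and L K :: "nat \<Rightarrow> real"
    and \<mu> :: real
    and xstar :: "real^'p"
  assumes n_pos: "1 \<le> n"
    and proper: "proper_fun h"
    and convex_h: "convex_efun h"
    and convex_g: "\<And>i. i \<in> {1..n} \<Longrightarrow> convex_on (edom h) (g i)"
    and gradient: "\<And>i y. i \<in> {1..n} \<Longrightarrow> y \<in> edom h \<Longrightarrow> GDERIV (g i) y :> Dg i y"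
    and hessian: "\<And>i y. i \<in> {1..n} \<Longrightarrow> y \<in> edom h \<Longrightarrow>
           (Dg i has_derivative (\<lambda>v. D2g i y *v v)) (at y)"
    and gradient_lipschitz: "\<And>i. i \<in> {1..n} \<Longrightarrow> (L i)-lipschitz_on (edom h) (Dg i)"
    and hessian_lipschitz: "\<And>i y z. i \<in> {1..n} \<Longrightarrow> y \<in> edom h \<Longrightarrow> z \<in> edom h \<Longrightarrow>
           onorm (\<lambda>v. (D2g i y - D2g i z) *v v) \<le> K i * norm (y - z)"
    and strongly_convex: "strongly_convex_efun h \<mu>"
    and optimal: "is_arg_min (composite n g h) (\<lambda>_. True) xstar"
begin

text \<open>
  \<open>z i\<close> is the point at which the quadratic of the \<open>i\<close>-th summand was built, its anchor, and \<open>A i\<close> is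
  the Hessian of that quadratic.
\<close>

abbreviation model_min :: "(nat \<Rightarrow> real^'p^'p) \<Rightarrow> (nat \<Rightarrow> real^'p) \<Rightarrow> real^'p \<Rightarrow> bool" where
  "model_min A z \<equiv> is_arg_min
     (composite n (\<lambda>i. quad_model (g i) (Dg i) (A i) (z i)) h) (\<lambda>_. True)"

abbreviation model_gradient :: "(nat \<Rightarrow> real^'p^'p) \<Rightarrow> (nat \<Rightarrow> real^'p) \<Rightarrow> real^'p \<Rightarrow> real^'p" where
  "model_gradient A z y \<equiv> ((\<Sum>i=1..n. Dg i (z i) + A i *v (y - z i)) /\<^sub>R real n)"

lemma mu_nonneg: "0 \<le> \<mu>"
  using strongly_convex by (simp add: strongly_convex_efun_def)

lemma arg_min_composite_edom:
  "is_arg_min (composite n q h) (\<lambda>_. True) a \<Longrightarrow> a \<in> edom h"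
  by (rule minimizer_in_edom[OF proper, where \<phi> = "\<lambda>y. (\<Sum>i=1..n. q i y) / real n"])
    (auto simp: is_arg_min_def composite_def not_less)

lemma arg_min_composite_subdifferential:
  assumes "is_arg_min (composite n q h) (\<lambda>_. True) a"
    and "\<And>i. i \<in> {1..n} \<Longrightarrow> GDERIV (q i) a :> G i"
  shows "- ((\<Sum>i=1..n. G i) /\<^sub>R real n) \<in> subdifferential h a"
proof (rule minimizer_neg_gradient_in_subdifferential[OF proper convex_h])
  show "ereal ((\<Sum>i=1..n. q i a) / real n) + h a \<le> ereal ((\<Sum>i=1..n. q i y) / real n) + h y" for y
    using assms(1) by (auto simp: is_arg_min_def composite_def not_less)
  show "GDERIV (\<lambda>y. (\<Sum>i=1..n. q i y) / real n) a :> (\<Sum>i=1..n. G i) /\<^sub>R real n"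
    by (rule GDERIV_average) (rule assms(2))
qed

lemma xstar_edom: "xstar \<in> edom h"
  by (rule arg_min_composite_edom[OF optimal])

lemma xstar_subgradient: "- ((\<Sum>i=1..n. Dg i xstar) /\<^sub>R real n) \<in> subdifferential h xstar"
  by (rule arg_min_composite_subdifferential[OF optimal]) (rule gradient[OF _ xstar_edom])

lemma model_min_subgradient:
  assumes "model_min A z a" and "\<And>i. i \<in> {1..n} \<Longrightarrow> symmetric_mat (A i)"
  shows "- model_gradient A z a \<in> subdifferential h a"
  by (rule arg_min_composite_subdifferential[OF assms(1)]) (rule quad_model_GDERIV[OF assms(2)])

lemma inner_average: "((\<Sum>i=1..n. G i) /\<^sub>R real n) \<bullet> v = (\<Sum>i=1..n. G i \<bullet> v) / real n"
  for v :: "real^'p"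
  by (simp add: inner_sum_left divide_inverse mult.commute)

lemma average_mono:
  fixes p q :: "nat \<Rightarrow> real"
  assumes "\<And>i. i \<in> {1..n} \<Longrightarrow> p i \<le> q i"
  shows "(\<Sum>i=1..n. p i) / real n \<le> (\<Sum>i=1..n. q i) / real n"
  by (intro divide_right_mono sum_mono assms) auto

lemma average_const: "(\<Sum>i=1..n. c) / real n = c" for c :: real
  using n_pos by simp

text \<open>
  The model objective inherits strong convexity with parameter \<open>\<mu> + m\<close>: \<open>\<mu>\<close> comes from \<open>h\<close> and \<open>m\<close> from
  the Hessians of the quadratics.
\<close>

lemma model_growth:
  assumes min: "model_min A z a" and y: "y \<in> edom h"
    and sym: "\<And>i. i \<in> {1..n} \<Longrightarrow> symmetric_mat (A i)"
    and lower: "\<And>i v. i \<in> {1..n} \<Longrightarrow> m * (norm v)\<^sup>2 \<le> v \<bullet> (A i *v v)"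
  shows "(\<Sum>i=1..n. quad_model (g i) (Dg i) (A i) (z i) a) / real n + real_of_ereal (h a)
           + (\<mu> + m) / 2 * (norm (y - a))\<^sup>2
         \<le> (\<Sum>i=1..n. quad_model (g i) (Dg i) (A i) (z i) y) / real n + real_of_ereal (h y)"
proof -
  let ?q = "\<lambda>i. quad_model (g i) (Dg i) (A i) (z i)"
  have "real_of_ereal (h a) - model_gradient A z a \<bullet> (y - a) + \<mu> / 2 * (norm (y - a))\<^sup>2
      \<le> real_of_ereal (h y)"
    using strongly_convex_growth[OF proper strongly_convex arg_min_composite_edom[OF min] y
        model_min_subgradient[OF min sym]] by simp
  moreover have "(\<Sum>i=1..n. ?q i a + (Dg i (z i) + A i *v (a - z i)) \<bullet> (y - a) + m / 2 * (norm (y - a))\<^sup>2) / real n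
      \<le> (\<Sum>i=1..n. ?q i y) / real n"
  proof (rule average_mono)
    fix i assume i: "i \<in> {1..n}"
    show "?q i a + (Dg i (z i) + A i *v (a - z i)) \<bullet> (y - a) + m / 2 * (norm (y - a))\<^sup>2 \<le> ?q i y"
      using quad_model_expansion[OF sym[OF i], of "g i" "Dg i" "z i" y a] lower[OF i, of "y - a"]
      by simp
  qed
  ultimately show ?thesis
    unfolding inner_average sum.distrib[of "\<lambda>i. _ i + _ i" "\<lambda>i. m / 2 * (norm (y - a))\<^sup>2"]
      sum.distrib[of "\<lambda>i. ?q i a"] add_divide_distrib average_const distrib_right by linarith
qed

lemma objective_growth:
  assumes y: "y \<in> edom h"
  shows "(\<Sum>i=1..n. g i xstar) / real n + real_of_ereal (h xstar) + \<mu> / 2 * (norm (y - xstar))\<^sup>2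
         \<le> (\<Sum>i=1..n. g i y) / real n + real_of_ereal (h y)"
proof -
  have "real_of_ereal (h xstar) - ((\<Sum>i=1..n. Dg i xstar) /\<^sub>R real n) \<bullet> (y - xstar)
      + \<mu> / 2 * (norm (y - xstar))\<^sup>2 \<le> real_of_ereal (h y)"
    using strongly_convex_growth[OF proper strongly_convex xstar_edom y xstar_subgradient] by simp
  moreover have "(\<Sum>i=1..n. g i xstar + Dg i xstar \<bullet> (y - xstar)) / real n \<le> (\<Sum>i=1..n. g i y) / real n"
    by (intro average_mono convex_on_gradient_inequality[OF convex_g] xstar_edom y gradient)
  ultimately show ?thesis
    unfolding inner_average sum.distrib add_divide_distrib by linarith
qed

text \<open>
  Uniqueness is what makes each iterate a function of the current anchors, and therefore of the
  indices sampled so far.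
\<close>

lemma model_min_unique:
  assumes "model_min A z a" "model_min A z b" and "0 < m"
    and "\<And>i. i \<in> {1..n} \<Longrightarrow> symmetric_mat (A i)"
    and "\<And>i v. i \<in> {1..n} \<Longrightarrow> m * (norm v)\<^sup>2 \<le> v \<bullet> (A i *v v)"
  shows "a = b"
proof -
  have "(\<mu> + m) * (norm (b - a))\<^sup>2 \<le> 0"
    using model_growth[OF assms(1) arg_min_composite_edom[OF assms(2)] assms(4,5)]
      model_growth[OF assms(2) arg_min_composite_edom[OF assms(1)] assms(4,5)]
    by (simp add: norm_minus_commute)
  then show ?thesis
    using mu_nonneg \<open>0 < m\<close> by (simp add: mult_le_0_iff)
qed

text \<open>
  Since \<open>L i \<le> m\<close>, the model majorizes the objective on \<open>edom h\<close>. The growth of the model at its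
  minimizer \<open>a\<close> and the growth of the objective at \<open>xstar\<close> therefore add up, and both are paid for by
  the gap between model and objective at \<open>xstar\<close>. Convexity of \<open>g i\<close> bounds this gap by the quadratic
  term alone.
\<close>

lemma model_min_square_distance:
  assumes min: "model_min A z a"
    and z: "\<And>i. i \<in> {1..n} \<Longrightarrow> z i \<in> edom h"
    and sym: "\<And>i. i \<in> {1..n} \<Longrightarrow> symmetric_mat (A i)"
    and lower: "\<And>i v. i \<in> {1..n} \<Longrightarrow> m * (norm v)\<^sup>2 \<le> v \<bullet> (A i *v v)"
    and upper: "\<And>i v. i \<in> {1..n} \<Longrightarrow> v \<bullet> (A i *v v) \<le> M * (norm v)\<^sup>2"
    and L_le: "\<And>i. i \<in> {1..n} \<Longrightarrow> L i \<le> m"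
  shows "(2 * \<mu> + m) * (norm (a - xstar))\<^sup>2 \<le> M * ((\<Sum>i=1..n. (norm (z i - xstar))\<^sup>2) / real n)"
proof -
  let ?q = "\<lambda>i. quad_model (g i) (Dg i) (A i) (z i)"
  have a: "a \<in> edom h" by (rule arg_min_composite_edom[OF min])
  have majorize: "(\<Sum>i=1..n. g i a) / real n \<le> (\<Sum>i=1..n. ?q i a) / real n"
  proof (rule average_mono)
    fix i assume i: "i \<in> {1..n}"
    have "g i a \<le> g i (z i) + Dg i (z i) \<bullet> (a - z i) + L i / 2 * (norm (a - z i))\<^sup>2"
      by (rule descent_lemma[OF convex_edom[OF proper convex_h] z[OF i] a gradient[OF i] gradient_lipschitz[OF i]])
    also have "L i / 2 * (norm (a - z i))\<^sup>2 \<le> m / 2 * (norm (a - z i))\<^sup>2"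
      using L_le[OF i] by (intro mult_right_mono) auto
    finally show "g i a \<le> ?q i a"
      using lower[OF i, of "a - z i"] by (simp add: quad_model_def inner_commute)
  qed
  have gap: "(\<Sum>i=1..n. ?q i xstar) / real n
      \<le> (\<Sum>i=1..n. g i xstar + M / 2 * (norm (z i - xstar))\<^sup>2) / real n"
  proof (rule average_mono)
    fix i assume i: "i \<in> {1..n}"
    have "g i (z i) + Dg i (z i) \<bullet> (xstar - z i) \<le> g i xstar"
      by (rule convex_on_gradient_inequality[OF convex_g[OF i] z[OF i] xstar_edom gradient[OF i z[OF i]]])
    then show "?q i xstar \<le> g i xstar + M / 2 * (norm (z i - xstar))\<^sup>2"
      using upper[OF i, of "xstar - z i"]
      by (simp add: quad_model_def inner_commute norm_minus_commute)
  qed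
  define T where "T = (\<Sum>i=1..n. (norm (z i - xstar))\<^sup>2) / real n"
  have "(\<Sum>i=1..n. g i xstar + M / 2 * (norm (z i - xstar))\<^sup>2) / real n
      = (\<Sum>i=1..n. g i xstar) / real n + M / 2 * T"
    by (simp add: T_def sum.distrib add_divide_distrib sum_distrib_left)
  with majorize gap model_growth[OF min xstar_edom sym lower] objective_growth[OF a]
  have "(\<mu> + m) / 2 * (norm (a - xstar))\<^sup>2 + \<mu> / 2 * (norm (a - xstar))\<^sup>2 \<le> M / 2 * T"
    unfolding norm_minus_commute[of xstar a] by linarith
  then show ?thesis
    unfolding T_def[symmetric] by (simp add: field_simps)
qed

text \<open>
  The subgradients of \<open>h\<close> furnished by optimality of \<open>a\<close> and of \<open>xstar\<close> are strongly monotone. What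
  remains is the error of the gradient of the model at \<open>xstar\<close>, and with exact Hessians this is the
  second-order Taylor remainder of the gradient. The resulting bound on the distance itself, rather
  than on its square, is quadratic in the distances of the anchors.
\<close>

lemma model_min_distance:
  assumes min: "model_min (\<lambda>i. D2g i (z i)) z a"
    and z: "\<And>i. i \<in> {1..n} \<Longrightarrow> z i \<in> edom h"
    and sym: "\<And>i. i \<in> {1..n} \<Longrightarrow> symmetric_mat (D2g i (z i))"
    and lower: "\<And>i v. i \<in> {1..n} \<Longrightarrow> m * (norm v)\<^sup>2 \<le> v \<bullet> (D2g i (z i) *v v)"
  shows "2 * (\<mu> + m) * norm (a - xstar) \<le> (\<Sum>i=1..n. K i * (norm (z i - xstar))\<^sup>2) / real n"
    (is "_ \<le> ?T")
proof (cases "a = xstar")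
  case True
  have "0 \<le> K i * (norm (z i - xstar))\<^sup>2" if i: "i \<in> {1..n}" for i
  proof -
    \<comment> \<open>The Lipschitz estimate itself shows that the right-hand side is nonnegative.\<close>
    have "0 \<le> onorm (\<lambda>v. (D2g i xstar - D2g i (z i)) *v v)"
      by (intro onorm_pos_le matrix_vector_mul_bounded_linear)
    also have "\<dots> \<le> K i * norm (xstar - z i)"
      using hessian_lipschitz[OF i xstar_edom z[OF i]] .
    finally show ?thesis
      by (simp add: power2_eq_square norm_minus_commute flip: mult.assoc)
  qed
  with True show ?thesis by (auto intro!: divide_nonneg_nonneg sum_nonneg)
next
  case False
  define w where "w = a - xstar"
  have a: "a \<in> edom h" by (rule arg_min_composite_edom[OF min])
  let ?A = "\<lambda>i. D2g i (z i)"
  \<comment> \<open>Adding the two growth inequalities gives strong monotonicity of the subdifferential.\<close>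
  have "\<mu> * (norm w)\<^sup>2 \<le> ((\<Sum>i=1..n. Dg i xstar) /\<^sub>R real n) \<bullet> w - model_gradient ?A z a \<bullet> w"
    using strongly_convex_growth[OF proper strongly_convex a xstar_edom model_min_subgradient[OF min sym]]
      strongly_convex_growth[OF proper strongly_convex xstar_edom a xstar_subgradient]
    by (simp add: w_def norm_minus_commute inner_diff_right)
  also have "\<dots> = (\<Sum>i=1..n. (Dg i xstar - Dg i (z i) - ?A i *v (a - z i)) \<bullet> w) / real n"
    unfolding inner_average
    by (simp add: sum_subtractf inner_diff_left inner_add_left sum.distrib diff_divide_distrib add_divide_distrib)
  also have "\<dots> \<le> (\<Sum>i=1..n. K i * (norm (z i - xstar))\<^sup>2 * (norm w / 2) - m * (norm w)\<^sup>2) / real n"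
  proof (rule average_mono)
    fix i assume i: "i \<in> {1..n}"
    have "(Dg i xstar - Dg i (z i) - ?A i *v (xstar - z i)) \<bullet> w \<le> K i / 2 * (norm (xstar - z i))\<^sup>2 * norm w"
      by (rule gradient_taylor_bound[OF convex_edom[OF proper convex_h] z[OF i] xstar_edom
            hessian[OF i] hessian_lipschitz[OF i _ z[OF i]]])
    moreover have "?A i *v (a - z i) = ?A i *v (xstar - z i) + ?A i *v w"
      by (simp add: w_def flip: matrix_vector_right_distrib)
    ultimately show "(Dg i xstar - Dg i (z i) - ?A i *v (a - z i)) \<bullet> w
        \<le> K i * (norm (z i - xstar))\<^sup>2 * (norm w / 2) - m * (norm w)\<^sup>2"
      using lower[OF i, of w] unfolding inner_commute[of w] norm_minus_commute[of xstar]
      by (simp add: inner_diff_left inner_add_left)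
  qed
  also have "\<dots> = ?T * (norm w / 2) - m * (norm w)\<^sup>2"
    unfolding sum_subtractf diff_divide_distrib average_const
    by (simp only: sum_distrib_right[symmetric] times_divide_eq_left)
  finally have "norm w * (2 * (\<mu> + m) * norm w) \<le> norm w * ?T"
    by (simp add: power2_eq_square algebra_simps)
  then have "2 * (\<mu> + m) * norm w \<le> ?T"
    by (rule mult_left_le_imp_le) (use False in \<open>simp add: w_def\<close>)
  then show ?thesis by (simp add: w_def)
qed

end

section \<open>Anchors along a sample path\<close>

text \<open>
  The point at which the quadratic \<open>g_i^k\<close> was built along a path. With exact Hessians the anchors
  determine the whole model, so they are the only state of the method.
\<close>

primrec anchor :: "(nat \<Rightarrow> nat) \<Rightarrow> (nat \<Rightarrow> 'a) \<Rightarrow> nat \<Rightarrow> nat \<Rightarrow> 'a" where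
  "anchor j x 0 i = x 0"
| "anchor j x (Suc k) i = (if i = j (Suc k) then x (Suc k) else anchor j x k i)"

lemma exact_hessians_anchor:
  assumes "proxtone_path n g Dg h x0 j H x" "exact_hessians n D2g j H x" "i \<in> {1..n}"
  shows "H k i = D2g i (anchor j x k i)"
  using assms by (induction k) (auto simp: proxtone_path_def exact_hessians_def)

lemma surrogate_anchor:
  assumes "proxtone_path n g Dg h x0 j H x" "i \<in> {1..n}"
  shows "surrogate g Dg j H x k i = quad_model (g i) (Dg i) (H k i) (anchor j x k i)"
  using assms by (induction k) (auto simp: proxtone_path_def)

lemma composite_cong:
  "(\<And>i. i \<in> {1..n} \<Longrightarrow> q i = r i) \<Longrightarrow> composite n q h = composite n r h"
  by (auto simp: composite_def fun_eq_iff)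

lemma mat_mult_vector: "mat c *v v = c *\<^sub>R v" for v :: "real^'p"
  by (simp add: vec_eq_iff matrix_vector_mult_def mat_def if_distrib if_distribR cong: if_cong)

lemma loewner_le_mat_lower:
  assumes "mat c \<preceq>\<^sub>L A" shows "c * (norm v)\<^sup>2 \<le> v \<bullet> (A *v v)"
  using assms
  by (simp add: loewner_le_def matrix_vector_mult_diff_rdistrib inner_diff_right
      mat_mult_vector power2_norm_eq_inner)

lemma loewner_le_mat_upper:
  assumes "A \<preceq>\<^sub>L mat c" shows "v \<bullet> (A *v v) \<le> c * (norm v)\<^sup>2"
  using assms
  by (simp add: loewner_le_def matrix_vector_mult_diff_rdistrib inner_diff_right
      mat_mult_vector power2_norm_eq_inner)

lemma loewner_le_mat_mat:
  assumes "mat c \<preceq>\<^sub>L (mat d :: real^'p^'p)" shows "c \<le> d"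
proof -
  obtain v :: "real^'p" where "norm v = 1" using vector_choose_size[of 1] by auto
  then show ?thesis
    using loewner_le_mat_lower[OF assms, of v] by (simp add: mat_mult_vector power2_norm_eq_inner[symmetric])
qed

section \<open>Independent choices\<close>

text \<open>
  The choice operator picks some outcome with the prescribed values of the variables in \<open>J\<close>; by
  hypothesis, \<open>Z\<close> does not depend on which one.
\<close>

lemma (in prob_space) finitely_determined_factor:
  fixes Z :: "'a \<Rightarrow> real"
  assumes det: "\<And>\<omega> \<omega>'. \<omega> \<in> space M \<Longrightarrow> \<omega>' \<in> space M \<Longrightarrow> (\<And>l. l \<in> J \<Longrightarrow> X l \<omega> = X l \<omega>') \<Longrightarrow> Z \<omega> = Z \<omega>'"
  shows "\<exists>F. \<forall>\<omega>\<in>space M. Z \<omega> = F (restrict (\<lambda>l. X l \<omega>) J)"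
proof (intro exI ballI)
  define F where "F p = Z (SOME \<omega>. \<omega> \<in> space M \<and> restrict (\<lambda>l. X l \<omega>) J = p)" for p
  fix \<omega> assume \<omega>: "\<omega> \<in> space M"
  let ?\<omega>' = "SOME \<omega>'. \<omega>' \<in> space M \<and> restrict (\<lambda>l. X l \<omega>') J = restrict (\<lambda>l. X l \<omega>) J"
  have same: "?\<omega>' \<in> space M \<and> restrict (\<lambda>l. X l ?\<omega>') J = restrict (\<lambda>l. X l \<omega>) J"
    by (rule someI[of _ \<omega>]) (simp add: \<omega>)
  have "Z \<omega> = Z ?\<omega>'"
  proof (rule det[OF \<omega> conjunct1[OF same]])
    fix l assume "l \<in> J"
    with fun_cong[OF conjunct2[OF same], of l] show "X l \<omega> = X l ?\<omega>'" by simp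
  qed
  then show "Z \<omega> = F (restrict (\<lambda>l. X l \<omega>) J)"
    by (simp add: F_def)
qed

context prob_space
begin

text \<open>
  \<open>Z\<close> factors through a random element of a finite set, on which every function is measurable and
  bounded; this gives integrability, and independence passes to \<open>Z\<close>.
\<close>

lemma
  fixes Z :: "'a \<Rightarrow> real"
  assumes ind: "indep_vars (\<lambda>_. count_space A) X I" and A: "finite A"
    and J: "finite J" "J \<subseteq> I"
    and det: "\<And>\<omega> \<omega>'. \<omega> \<in> space M \<Longrightarrow> \<omega>' \<in> space M \<Longrightarrow> (\<And>l. l \<in> J \<Longrightarrow> X l \<omega> = X l \<omega>') \<Longrightarrow> Z \<omega> = Z \<omega>'"
  shows integrable_finitely_determined: "integrable M Z"
    and expectation_indicator_mult_finitely_determined: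
      "i \<in> I - J \<Longrightarrow> expectation (\<lambda>\<omega>. indicator {c} (X i \<omega>) * Z \<omega>) = prob {\<omega> \<in> space M. X i \<omega> = c} * expectation Z"
proof -
  have "\<exists>F. \<forall>\<omega>\<in>space M. Z \<omega> = F (restrict (\<lambda>l. X l \<omega>) J)"
    by (rule finitely_determined_factor) (rule det)
  then obtain F where F: "\<And>\<omega>. \<omega> \<in> space M \<Longrightarrow> Z \<omega> = F (restrict (\<lambda>l. X l \<omega>) J)"
    by blast
  have X: "X l \<in> measurable M (count_space A)" if "l \<in> I" for l
    using ind that by (auto simp: indep_vars_def)
  have PiM: "PiM J (\<lambda>_. count_space A) = count_space (PiE J (\<lambda>_. A))"
    using J A by (intro count_space_PiM_finite) (auto intro: countable_finite)
  have PiM_i: "PiM {i} (\<lambda>_. count_space A) = count_space (PiE {i} (\<lambda>_. A))"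
    using A by (intro count_space_PiM_finite) (auto intro: countable_finite)
  have XJ: "(\<lambda>\<omega>. restrict (\<lambda>l. X l \<omega>) J) \<in> measurable M (PiM J (\<lambda>_. count_space A))"
    using J X by (intro measurable_restrict) auto
  have FJ: "F \<in> borel_measurable (PiM J (\<lambda>_. count_space A))"
    unfolding PiM by simp
  have meas: "(\<lambda>\<omega>. F (restrict (\<lambda>l. X l \<omega>) J)) \<in> borel_measurable M"
    by (rule measurable_compose[OF XJ FJ])
  have fin: "finite (PiE J (\<lambda>_. A))" using J A by (intro finite_PiE) auto
  have int: "integrable M (\<lambda>\<omega>. F (restrict (\<lambda>l. X l \<omega>) J))"
  proof (rule integrable_const_bound[OF _ meas])
    show "AE \<omega> in M. norm (F (restrict (\<lambda>l. X l \<omega>) J)) \<le> Max ((\<lambda>p. norm (F p)) ` PiE J (\<lambda>_. A))"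
      using measurable_space[OF XJ] fin by (intro AE_I2 Max_ge) (auto simp: PiM)
  qed
  then show "integrable M Z"
    using F by (subst Bochner_Integration.integrable_cong[OF refl F]) auto
  assume i: "i \<in> I - J"
  have "indep_var (PiM {i} (\<lambda>_. count_space A)) (\<lambda>\<omega>. restrict (\<lambda>l. X l \<omega>) {i})
     (PiM J (\<lambda>_. count_space A)) (\<lambda>\<omega>. restrict (\<lambda>l. X l \<omega>) J)"
    using i J by (intro indep_var_restrict[OF ind]) auto
  then have "indep_var borel ((\<lambda>p. indicator {c} (p i)) \<circ> (\<lambda>\<omega>. restrict (\<lambda>l. X l \<omega>) {i}))
     borel (F \<circ> (\<lambda>\<omega>. restrict (\<lambda>l. X l \<omega>) J))"
    by (rule indep_var_compose[OF _ _ FJ]) (simp add: PiM_i)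
  then have indep: "indep_var borel (\<lambda>\<omega>. indicator {c} (X i \<omega>) :: real) borel (\<lambda>\<omega>. F (restrict (\<lambda>l. X l \<omega>) J))"
    by (simp add: comp_def)
  have Xi: "{\<omega> \<in> space M. X i \<omega> = c} \<in> events"
  proof -
    have "X i -` ({c} \<inter> A) \<inter> space M \<in> events"
      using i by (intro measurable_sets[OF X]) auto
    also have "X i -` ({c} \<inter> A) \<inter> space M = {\<omega> \<in> space M. X i \<omega> = c}"
      using measurable_space[OF X] i by auto
    finally show ?thesis .
  qed
  have ind_eq: "indicator {c} (X i \<omega>) = (indicator {\<omega> \<in> space M. X i \<omega> = c} \<omega> :: real)" if "\<omega> \<in> space M" for \<omega>
    using that by (auto simp: indicator_def)
  have int_i: "integrable M (\<lambda>\<omega>. indicator {c} (X i \<omega>) :: real)"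
    by (rule Bochner_Integration.integrable_cong[OF refl ind_eq, THEN iffD2])
      (simp_all add: integrable_indicator_iff Xi less_top[symmetric])
  have "expectation (\<lambda>\<omega>. indicator {c} (X i \<omega>) * Z \<omega>)
      = expectation (\<lambda>\<omega>. indicator {c} (X i \<omega>) * F (restrict (\<lambda>l. X l \<omega>) J))"
    using F by (intro Bochner_Integration.integral_cong) auto
  also have "\<dots> = expectation (\<lambda>\<omega>. indicator {c} (X i \<omega>)) * expectation (\<lambda>\<omega>. F (restrict (\<lambda>l. X l \<omega>) J))"
    by (rule indep_var_lebesgue_integral[OF indep int_i int])
  also have "expectation (\<lambda>\<omega>. F (restrict (\<lambda>l. X l \<omega>) J)) = expectation Z"
    using F by (intro Bochner_Integration.integral_cong) auto
  also have "expectation (\<lambda>\<omega>. indicator {c} (X i \<omega>) :: real) = prob {\<omega> \<in> space M. X i \<omega> = c}"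
    using Bochner_Integration.integral_cong[OF refl ind_eq, of M] Xi by simp
  finally show "expectation (\<lambda>\<omega>. indicator {c} (X i \<omega>) * Z \<omega>) = prob {\<omega> \<in> space M. X i \<omega> = c} * expectation Z" .
qed

lemma expectation_independent_choice:
  fixes Z W :: "'a \<Rightarrow> real" and c :: 'c
  assumes ind: "indep_vars (\<lambda>_. count_space (A :: 'c set)) X I" "finite A" "finite J" "J \<subseteq> I" and i: "i \<in> I - J"
    and Z: "\<And>\<omega> \<omega>'. \<omega> \<in> space M \<Longrightarrow> \<omega>' \<in> space M \<Longrightarrow> (\<And>l. l \<in> J \<Longrightarrow> X l \<omega> = X l \<omega>') \<Longrightarrow> Z \<omega> = Z \<omega>'"
    and W: "\<And>\<omega> \<omega>'. \<omega> \<in> space M \<Longrightarrow> \<omega>' \<in> space M \<Longrightarrow> (\<And>l. l \<in> J \<Longrightarrow> X l \<omega> = X l \<omega>') \<Longrightarrow> W \<omega> = W \<omega>'"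
  defines "\<pi> \<equiv> prob {\<omega> \<in> space M. X i \<omega> = c}"
  shows "expectation (\<lambda>\<omega>. if X i \<omega> = c then Z \<omega> else W \<omega>) = \<pi> * expectation Z + (1 - \<pi>) * expectation W"
proof -
  have ZW: "Z \<omega> - W \<omega> = Z \<omega>' - W \<omega>'"
    if "\<omega> \<in> space M" "\<omega>' \<in> space M" "\<And>l. l \<in> J \<Longrightarrow> X l \<omega> = X l \<omega>'" for \<omega> \<omega>'
    using Z[OF that] W[OF that] by simp
  have intZ: "integrable M Z"
    by (rule integrable_finitely_determined[OF ind]) (rule Z)
  have intW: "integrable M W"
    by (rule integrable_finitely_determined[OF ind]) (rule W)
  have ev: "integrable M (\<lambda>\<omega>. indicator {c} (X i \<omega>) * (Z \<omega> - W \<omega>))"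
  proof (rule integrable_finitely_determined[OF ind(1,2)])
    show "finite (insert i J)" "insert i J \<subseteq> I" using ind(3,4) i by auto
    fix \<omega> \<omega>' assume "\<omega> \<in> space M" "\<omega>' \<in> space M" "\<And>l. l \<in> insert i J \<Longrightarrow> X l \<omega> = X l \<omega>'"
    with ZW[of \<omega> \<omega>'] show "indicator {c} (X i \<omega>) * (Z \<omega> - W \<omega>) = indicator {c} (X i \<omega>') * (Z \<omega>' - W \<omega>')"
      by simp
  qed
  have "expectation (\<lambda>\<omega>. if X i \<omega> = c then Z \<omega> else W \<omega>)
      = expectation (\<lambda>\<omega>. W \<omega> + indicator {c} (X i \<omega>) * (Z \<omega> - W \<omega>))"
    by (intro Bochner_Integration.integral_cong) auto
  also have "\<dots> = expectation W + \<pi> * expectation (\<lambda>\<omega>. Z \<omega> - W \<omega>)"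
  proof -
    have "expectation (\<lambda>\<omega>. indicator {c} (X i \<omega>) * (Z \<omega> - W \<omega>)) = \<pi> * expectation (\<lambda>\<omega>. Z \<omega> - W \<omega>)"
      unfolding \<pi>_def
      by (rule expectation_indicator_mult_finitely_determined[OF ind _ i]) (rule ZW)
    with intW ev show ?thesis by simp
  qed
  also have "\<dots> = \<pi> * expectation Z + (1 - \<pi>) * expectation W"
    using intZ intW by (simp add: algebra_simps)
  finally show ?thesis .
qed

end

section \<open>The rate of convergence\<close>

text \<open>
  The bracket, being an average of \<open>\<rho>\<close> and \<open>1\<close>, is at most the larger of the two. If \<open>\<rho> \<ge> 1\<close> the
  comparison reduces to \<open>m \<le> 2 * (\<mu> + m)\<close>, and if \<open>\<rho> \<le> 1\<close> to \<open>m \<le> M + L\<close> and \<open>2 * \<mu> + m \<le> 2 * (\<mu> + m)\<close>.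
  The last inequality relies on the factor 2 in the denominator on the left.
\<close>

lemma rate_comparison:
  fixes K L m M \<mu> :: real and n :: nat
  assumes "0 < m" "m \<le> M" "0 \<le> \<mu>" "0 \<le> L" "0 \<le> K" "1 \<le> n"
  defines "\<rho> \<equiv> (M + L) / (2 * \<mu> + m)"
  shows "K / (2 * (\<mu> + m)) * (1 / real n * \<rho> + (1 - 1 / real n)) \<le> (K + 2 * L) / m * \<rho> + 2 * L / m"
proof -
  define q where "q = 1 / real n * \<rho> + (1 - 1 / real n)"
  have \<rho>: "0 \<le> \<rho>" using assms by (simp add: \<rho>_def)
  have "q / (2 * (\<mu> + m)) \<le> \<rho> / m"
  proof (cases "\<rho> \<le> 1")
    case True
    then have "1 / real n * \<rho> \<le> 1 / real n * 1" by (intro mult_left_mono) auto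
    then have "q \<le> 1" by (simp add: q_def)
    then have "q / (2 * (\<mu> + m)) \<le> 1 / (2 * \<mu> + m)"
      using assms by (intro frac_le) auto
    also have "\<dots> \<le> ((M + L) / m) / (2 * \<mu> + m)"
      using assms by (intro divide_right_mono) auto
    finally show ?thesis by (simp add: \<rho>_def mult.commute)
  next
    case False
    then have "(1 - 1 / real n) * 1 \<le> (1 - 1 / real n) * \<rho>"
      using \<open>1 \<le> n\<close> by (intro mult_left_mono) auto
    then have "q \<le> \<rho>" by (simp add: q_def algebra_simps)
    then show ?thesis using assms \<rho> by (intro frac_le) auto
  qed
  then have "K * (q / (2 * (\<mu> + m))) \<le> K * (\<rho> / m)"
    using \<open>0 \<le> K\<close> by (rule mult_left_mono)
  also have "\<dots> \<le> (K + 2 * L) / m * \<rho>"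
    using mult_right_mono[of "K / m" "(K + 2 * L) / m" \<rho>] \<open>0 < m\<close> \<open>0 \<le> L\<close> \<rho>
    by (simp add: divide_right_mono)
  also have "\<dots> \<le> (K + 2 * L) / m * \<rho> + 2 * L / m"
    using assms by simp
  finally show ?thesis by (simp add: q_def)
qed

lemma uniform_sampling_prob:
  assumes "uniform_sampling P n j" "i \<in> {1..n}" "1 \<le> k"
  shows "measure P {\<omega> \<in> space P. j k \<omega> = i} = 1 / real n"
proof -
  have meas: "j k \<in> measurable P (count_space {1..n})"
    using assms by (auto simp: uniform_sampling_def prob_space.indep_vars_def)
  have "measure P {\<omega> \<in> space P. j k \<omega> = i} = measure (distr P (count_space {1..n}) (j k)) {i}"
    using assms(2) by (subst measure_distr[OF meas]) (auto intro!: arg_cong[where f = "measure P"])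
  also have "\<dots> = 1 / real n"
    using assms by (simp add: uniform_sampling_def measure_uniform_count_measure)
  finally show ?thesis .
qed

theorem theorem3p3:
  fixes n :: nat
    and g :: "nat \<Rightarrow> real^'p \<Rightarrow> real"
    and Dg :: "nat \<Rightarrow> real^'p \<Rightarrow> real^'p"
    and D2g :: "nat \<Rightarrow> real^'p \<Rightarrow> real^'p^'p"
    and U :: "nat \<Rightarrow> (real^'p) set"
    and h :: "real^'p \<Rightarrow> ereal"
    and L K :: "nat \<Rightarrow> real"
    and Lmax Kavg \<mu>h m M :: real
    and x0 xstar :: "real^'p"
    and P :: "'w measure"
    and j :: "nat \<Rightarrow> 'w \<Rightarrow> nat"
    and H :: "nat \<Rightarrow> nat \<Rightarrow> 'w \<Rightarrow> real^'p^'p"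
    and x :: "nat \<Rightarrow> 'w \<Rightarrow> real^'p"
  assumes "1 \<le> n"
    and "proper_fun h" "convex_efun h" "lsc_efun h" "closed (edom h)"
    and "\<And>i. i \<in> {1..n} \<Longrightarrow> open (U i) \<and> edom h \<subseteq> U i \<and> convex_on (U i) (g i)"
    and "\<And>i y. i \<in> {1..n} \<Longrightarrow> y \<in> U i \<Longrightarrow> GDERIV (g i) y :> Dg i y"
    and "\<And>i y. i \<in> {1..n} \<Longrightarrow> y \<in> U i \<Longrightarrow> (Dg i has_derivative (\<lambda>v. D2g i y *v v)) (at y)"
    and "\<And>i. i \<in> {1..n} \<Longrightarrow> 0 < L i \<and> 0 < K i"
    and "\<And>i. i \<in> {1..n} \<Longrightarrow> (L i)-lipschitz_on (edom h) (Dg i)"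
    and "\<And>i y z. i \<in> {1..n} \<Longrightarrow> y \<in> edom h \<Longrightarrow> z \<in> edom h \<Longrightarrow>
           onorm (\<lambda>v. (D2g i y - D2g i z) *v v) \<le> K i * norm (y - z)"
    and "0 \<le> \<mu>h" "strongly_convex_efun h \<mu>h"
    and "is_arg_min (composite n g h) (\<lambda>_. True) xstar"
    and "x0 \<in> edom (composite n g h)"
    and "uniform_sampling P n j"
    and "\<And>\<omega>. \<omega> \<in> space P \<Longrightarrow>
           proxtone_path n g Dg h x0 (\<lambda>k. j k \<omega>) (\<lambda>k i. H k i \<omega>) (\<lambda>k. x k \<omega>)"
    and "\<And>\<omega>. \<omega> \<in> space P \<Longrightarrow>
           exact_hessians n D2g (\<lambda>k. j k \<omega>) (\<lambda>k i. H k i \<omega>) (\<lambda>k. x k \<omega>)"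
    and "0 < m" "m \<le> M"
    and "\<And>\<omega> i k. \<omega> \<in> space P \<Longrightarrow> i \<in> {1..n} \<Longrightarrow>
           mat (L i) \<preceq>\<^sub>L (mat m :: real^'p^'p) \<and> mat m \<preceq>\<^sub>L H k i \<omega> \<and> H k i \<omega> \<preceq>\<^sub>L mat M"
    and "Lmax = Max (L ` {1..n})"
    and "Kavg = (\<Sum>i=1..n. K i) / real n"
  shows "\<forall>k\<ge>1. prob_space.expectation P (\<lambda>\<omega>. norm (x (k + 1) \<omega> - xstar))
      \<le> ((Kavg + 2 * Lmax) / m * ((M + Lmax) / (2 * \<mu>h + m)) + 2 * Lmax / m)
         * (1 / real n * ((M + Lmax) / (2 * \<mu>h + m)) + (1 - 1 / real n)) ^ (k - 1)
         * (norm (xstar - x0))\<^sup>2"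
proof -
  have n: "1 \<le> n" and m: "0 < m" "m \<le> M" and \<mu>h: "0 \<le> \<mu>h" by fact+
  note path = assms(17) and hess = assms(18) and bounds = assms(21)
  interpret prob_space P
    using assms(16) by (simp add: uniform_sampling_def)
  interpret composite_problem n g Dg D2g h L K \<mu>h xstar
  proof
    fix i assume i: "i \<in> {1..n}"
    show "convex_on (edom h) (g i)"
      using assms(6)[OF i] convex_edom[OF assms(2,3)] convex_on_subset by blast
    show "GDERIV (g i) y :> Dg i y" "(Dg i has_derivative (\<lambda>v. D2g i y *v v)) (at y)"
      if "y \<in> edom h" for y
      using assms(6-8)[OF i] that by auto
  qed (fact assms)+
  have ind: "indep_vars (\<lambda>_. count_space {1..n}) j {1..}"
    using assms(16) by (simp add: uniform_sampling_def)
  have "L 1 \<le> Lmax"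
    unfolding assms(22) using n by (intro Max_ge) auto
  then have Lmax_nonneg: "0 \<le> Lmax"
    using assms(9)[of 1] n by simp
  have Kavg_nonneg: "0 \<le> Kavg"
    unfolding assms(23) using assms(9) by (intro divide_nonneg_nonneg sum_nonneg) (auto intro: less_imp_le)

  define z where "z \<omega> = anchor (\<lambda>k. j k \<omega>) (\<lambda>k. x k \<omega>)" for \<omega>
  have H_eq: "H k i \<omega> = D2g i (z \<omega> k i)" if "\<omega> \<in> space P" "i \<in> {1..n}" for \<omega> k i
    using exact_hessians_anchor[OF path[OF that(1)] hess[OF that(1)] that(2)] by (simp add: z_def)
  have step: "model_min (\<lambda>i. D2g i (z \<omega> k i)) (z \<omega> k) (x (Suc k) \<omega>)" if \<omega>: "\<omega> \<in> space P" for \<omega> k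
  proof -
    have eq: "composite n (surrogate g Dg (\<lambda>k. j k \<omega>) (\<lambda>k i. H k i \<omega>) (\<lambda>k. x k \<omega>) k) h
        = composite n (\<lambda>i. quad_model (g i) (Dg i) (D2g i (z \<omega> k i)) (z \<omega> k i)) h"
    proof (rule composite_cong)
      fix i assume i: "i \<in> {1..n}"
      show "surrogate g Dg (\<lambda>k. j k \<omega>) (\<lambda>k i. H k i \<omega>) (\<lambda>k. x k \<omega>) k i
          = quad_model (g i) (Dg i) (D2g i (z \<omega> k i)) (z \<omega> k i)"
        using surrogate_anchor[OF path[OF \<omega>] i, of k] H_eq[OF \<omega> i, of k] by (simp add: z_def)
    qed
    have "is_arg_min (composite n (surrogate g Dg (\<lambda>k. j k \<omega>) (\<lambda>k i. H k i \<omega>) (\<lambda>k. x k \<omega>) k) h)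
        (\<lambda>_. True) (x (Suc k) \<omega>)"
      using path[OF \<omega>] by (simp add: proxtone_path_def)
    then show ?thesis by (simp only: eq)
  qed
  have x_0: "x 0 \<omega> = x0" if "\<omega> \<in> space P" for \<omega>
    using path[OF that] by (simp add: proxtone_path_def)
  have x0: "x0 \<in> edom h"
    using assms(15) by (cases "h x0") (auto simp: edom_def composite_def)
  have x_edom: "x k \<omega> \<in> edom h" if "\<omega> \<in> space P" for k \<omega>
    using x0 x_0[OF that] arg_min_composite_edom[OF step[OF that]] by (cases k) auto
  have z_edom: "z \<omega> k i \<in> edom h" if "\<omega> \<in> space P" for \<omega> k i
    by (induction k) (auto simp: z_def x_edom that)
  have curvature: "symmetric_mat (D2g i (z \<omega> k i))"
      "m * (norm v)\<^sup>2 \<le> v \<bullet> (D2g i (z \<omega> k i) *v v)"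
      "v \<bullet> (D2g i (z \<omega> k i) *v v) \<le> M * (norm v)\<^sup>2"
    if "\<omega> \<in> space P" "i \<in> {1..n}" for \<omega> k i v
    using bounds[OF that, of k] unfolding H_eq[OF that]
    by (auto simp: loewner_le_mat_lower loewner_le_mat_upper) (simp add: loewner_le_def)
  have L_le: "L i \<le> m" if "\<omega> \<in> space P" "i \<in> {1..n}" for \<omega> i
    using bounds[OF that] loewner_le_mat_mat by blast

  define \<rho> q D where "\<rho> = (M + Lmax) / (2 * \<mu>h + m)"
    and "q = 1 / real n * \<rho> + (1 - 1 / real n)" and "D = (norm (xstar - x0))\<^sup>2"
  have \<rho>_nonneg: "0 \<le> \<rho>" using m \<mu>h Lmax_nonneg by (simp add: \<rho>_def)
  have q_nonneg: "0 \<le> q" using \<rho>_nonneg n by (simp add: q_def)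
  define Y where "Y k i \<omega> = (norm (z \<omega> k i - xstar))\<^sup>2" for k i \<omega>
  have square_step: "(norm (x (Suc k) \<omega> - xstar))\<^sup>2 \<le> \<rho> * ((\<Sum>i=1..n. Y k i \<omega>) / real n)"
    if \<omega>: "\<omega> \<in> space P" for k \<omega>
  proof -
    have "(2 * \<mu>h + m) * (norm (x (Suc k) \<omega> - xstar))\<^sup>2 \<le> M * ((\<Sum>i=1..n. Y k i \<omega>) / real n)"
      unfolding Y_def by (rule model_min_square_distance[OF step[OF \<omega>] z_edom[OF \<omega>] curvature[OF \<omega>] L_le[OF \<omega>]])
    also have "\<dots> \<le> (M + Lmax) * ((\<Sum>i=1..n. Y k i \<omega>) / real n)"
      using Lmax_nonneg by (intro mult_right_mono divide_nonneg_nonneg sum_nonneg) (auto simp: Y_def)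
    finally show ?thesis
      using m \<mu>h unfolding \<rho>_def times_divide_eq_left
      by (subst pos_le_divide_eq) (auto simp: mult.commute)
  qed
  have linear_step: "norm (x (Suc k) \<omega> - xstar) \<le> (\<Sum>i=1..n. K i * Y k i \<omega>) / real n / (2 * (\<mu>h + m))"
    if \<omega>: "\<omega> \<in> space P" for k \<omega>
    using model_min_distance[OF step[OF \<omega>] z_edom[OF \<omega>] curvature(1,2)[OF \<omega>]] m \<mu>h
    unfolding Y_def by (subst pos_le_divide_eq) (auto simp: mult.commute)

  \<comment> \<open>Uniqueness of the model minimizers propagates equality of samples to equality of anchors and
  iterates; this is how the method is seen to be adapted to the sampling.\<close>
  have anchor_determined: "z \<omega> k = z \<omega>' k"
    and iterate_determined: "x (Suc k) \<omega> = x (Suc k) \<omega>'"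
    if \<omega>: "\<omega> \<in> space P" "\<omega>' \<in> space P" and same: "\<And>l. l \<in> {1..k} \<Longrightarrow> j l \<omega> = j l \<omega>'" for \<omega> \<omega>' k
  proof -
    have next_same: "x (Suc l) \<omega> = x (Suc l) \<omega>'" if "z \<omega> l = z \<omega>' l" for l
      by (rule model_min_unique[OF step[OF \<omega>(1)] step[OF \<omega>(2), of l, folded that] m(1)
            curvature(1,2)[OF \<omega>(1)]])
    have "z \<omega> l = z \<omega>' l" if "l \<le> k" for l
      using that
    proof (induction l)
      case 0
      show ?case by (simp add: z_def fun_eq_iff x_0 \<omega>)
    next
      case (Suc l)
      then have "z \<omega> l = z \<omega>' l" by simp
      with next_same[of l] same[of "Suc l"] Suc.prems show ?case by (simp add: z_def fun_eq_iff)
    qed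
    then show "z \<omega> k = z \<omega>' k" by simp
    then show "x (Suc k) \<omega> = x (Suc k) \<omega>'" by (rule next_same)
  qed
  have J: "{1..k} \<subseteq> {1..}" for k :: nat by auto
  have integrable: "integrable P Z"
    if Z: "\<And>\<omega> \<omega>'. z \<omega> k = z \<omega>' k \<Longrightarrow> x (Suc k) \<omega> = x (Suc k) \<omega>' \<Longrightarrow> Z \<omega> = Z \<omega>'"
    for Z :: "'w \<Rightarrow> real" and k
  proof (rule integrable_finitely_determined[OF ind finite_atLeastAtMost finite_atLeastAtMost J[of k]])
    fix \<omega> \<omega>' assume same: "\<omega> \<in> space P" "\<omega>' \<in> space P" "\<And>l. l \<in> {1..k} \<Longrightarrow> j l \<omega> = j l \<omega>'"
    show "Z \<omega> = Z \<omega>'" by (rule Z[OF anchor_determined[OF same] iterate_determined[OF same]])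
  qed
  have int_Y: "integrable P (Y k i)" for k i
    by (rule integrable[of k]) (simp add: Y_def)
  have int_X: "integrable P (\<lambda>\<omega>. (norm (x (Suc k) \<omega> - xstar))\<^sup>2)" for k
    by (rule integrable[of k]) simp
  have int_d: "integrable P (\<lambda>\<omega>. norm (x (Suc k) \<omega> - xstar))" for k
    by (rule integrable[of k]) simp

  have Y_bound: "expectation (Y k i) \<le> q ^ k * D" if "i \<in> {1..n}" for k i
    using that
  proof (induction k arbitrary: i)
    case 0
    have "expectation (Y 0 i) = expectation (\<lambda>_. D)"
      by (intro Bochner_Integration.integral_cong) (auto simp: Y_def z_def x_0 D_def norm_minus_commute)
    then show ?case by (simp add: prob_space)
  next
    case (Suc k)
    let ?X = "\<lambda>\<omega>. (norm (x (Suc k) \<omega> - xstar))\<^sup>2"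
    have "expectation ?X \<le> expectation (\<lambda>\<omega>. \<rho> * ((\<Sum>i=1..n. Y k i \<omega>) / real n))"
      by (intro integral_mono int_X square_step) (rule integrable[of k], simp add: Y_def)
    also have "\<dots> = \<rho> * ((\<Sum>i=1..n. expectation (Y k i)) / real n)"
      by (simp add: int_Y)
    also have "\<dots> \<le> \<rho> * ((\<Sum>i=1..n. q ^ k * D) / real n)"
      by (intro mult_left_mono average_mono Suc.IH \<rho>_nonneg)
    finally have X: "expectation ?X \<le> \<rho> * (q ^ k * D)"
      unfolding average_const .
    \<comment> \<open>The new iterate replaces the \<open>i\<close>-th anchor with probability \<open>1 / n\<close>, independently of
    the new iterate and of the current anchor.\<close>
    have "expectation (Y (Suc k) i) = expectation (\<lambda>\<omega>. if j (Suc k) \<omega> = i then ?X \<omega> else Y k i \<omega>)"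
      by (intro Bochner_Integration.integral_cong) (auto simp: Y_def z_def)
    also have "\<dots> = 1 / real n * expectation ?X + (1 - 1 / real n) * expectation (Y k i)"
    proof (subst expectation_independent_choice[OF ind finite_atLeastAtMost finite_atLeastAtMost J[of k]])
      fix \<omega> \<omega>' assume same: "\<omega> \<in> space P" "\<omega>' \<in> space P" "\<And>l. l \<in> {1..k} \<Longrightarrow> j l \<omega> = j l \<omega>'"
      have "x (Suc k) \<omega> = x (Suc k) \<omega>'" by (rule iterate_determined[OF same])
      then show "?X \<omega> = ?X \<omega>'" by simp
      have "z \<omega> k = z \<omega>' k" by (rule anchor_determined[OF same])
      then show "Y k i \<omega> = Y k i \<omega>'" by (simp add: Y_def)
    qed (use uniform_sampling_prob[OF assms(16) Suc.prems, of "Suc k"] in simp_all)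
    also have "\<dots> \<le> 1 / real n * (\<rho> * (q ^ k * D)) + (1 - 1 / real n) * (q ^ k * D)"
      using n X Suc.IH[OF Suc.prems] by (intro add_mono mult_left_mono) auto
    also have "\<dots> = q ^ Suc k * D"
      by (simp add: q_def algebra_simps)
    finally show ?case .
  qed

  show ?thesis
  proof (intro allI impI)
    fix k :: nat assume k: "1 \<le> k"
    have "expectation (\<lambda>\<omega>. norm (x (k + 1) \<omega> - xstar))
        \<le> expectation (\<lambda>\<omega>. (\<Sum>i=1..n. K i * Y k i \<omega>) / real n / (2 * (\<mu>h + m)))"
      unfolding Suc_eq_plus1[symmetric]
      by (intro integral_mono int_d linear_step) (rule integrable[of k], simp add: Y_def)
    also have "\<dots> = (\<Sum>i=1..n. K i * expectation (Y k i)) / real n / (2 * (\<mu>h + m))"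
      by (simp add: int_Y)
    also have "\<dots> \<le> (\<Sum>i=1..n. K i * (q ^ k * D)) / real n / (2 * (\<mu>h + m))"
      using m \<mu>h assms(9)
      by (intro divide_right_mono average_mono mult_left_mono Y_bound) (auto intro: less_imp_le)
    \<comment> \<open>One factor \<open>q\<close> is given up, because the exponent in the claim is \<open>k - 1\<close>.\<close>
    also have "\<dots> = (Kavg / (2 * (\<mu>h + m)) * q) * (q ^ (k - 1) * D)"
      using k by (cases k) (simp_all add: assms(23) sum_distrib_right[symmetric])
    also have "\<dots> \<le> ((Kavg + 2 * Lmax) / m * \<rho> + 2 * Lmax / m) * (q ^ (k - 1) * D)"
      unfolding q_def[unfolded \<rho>_def] \<rho>_def
      using m \<mu>h n Lmax_nonneg Kavg_nonneg q_nonneg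
      by (intro mult_right_mono rate_comparison) (auto simp: D_def q_def \<rho>_def)
    finally show "expectation (\<lambda>\<omega>. norm (x (k + 1) \<omega> - xstar))
      \<le> ((Kavg + 2 * Lmax) / m * ((M + Lmax) / (2 * \<mu>h + m)) + 2 * Lmax / m)
         * (1 / real n * ((M + Lmax) / (2 * \<mu>h + m)) + (1 - 1 / real n)) ^ (k - 1)
         * (norm (xstar - x0))\<^sup>2"
      by (simp only: q_def \<rho>_def D_def mult.assoc)
  qed
qed

end
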